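(* Let $X$ be a separable reflexive Banach space over $\mathbb{K}\in\{\mathbb{R},\mathbb{C}\}$ and let $T$ be a closed operator in $X$. Then the point spectrum $\sigma_p(T)$ is an $F_\sigma$ subset of $\mathbb{K}$. In particular, the point spectrum of a closed densely defined operator in a separable Hilbert space is $F_\sigma$.
   Context: An operator in $X$ is a linear map $T\colon D(T)\to X$ defined on a linear subspace $D(T)$ of $X$ (not necessarily bounded or densely defined). $T$ is closed if its graph $\{(x,Tx):x\in D(T)\}$ is a closed subset of $X\times X$. The point spectrum is $\sigma_p(T)=\{\lambda\in\mathbb{K}:\ker(T-\lambda)\neq\{0\}\}$, where $T-\lambda$ has domain $D(T)$. *)

theory Defs
  imports "HOL-Analysis.Analysis"
begin

text \<open>
  The scalar field K is a type \<open>'k\<close>, to be taken as \<^typ>\<open>real\<close> or \<^typ>\<open>complex\<close>.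
  The library's normed spaces are real, so the scalar multiplication over \<open>'k\<close> is an explicit
  parameter that extends \<^const>\<open>scaleR\<close>; norm, metric and completeness are those of the type.
\<close>

locale normed_space_over = vector_space sc
  for sc :: "'k::real_normed_field \<Rightarrow> 'a::real_normed_vector \<Rightarrow> 'a" +
  assumes scale_of_real: "sc (of_real r) x = r *\<^sub>R x"
    and norm_scale: "norm (sc c x) = norm c * norm x"

lemma normed_space_over_scaleR: "normed_space_over scaleR"
  by unfold_locales (auto simp: algebra_simps)

definition dual_over ::
    "('k::real_normed_field \<Rightarrow> 'a::real_normed_vector \<Rightarrow> 'a) \<Rightarrow> ('a \<Rightarrow> 'k) set"
  where "dual_over sc = {f. bounded_linear f \<and> (\<forall>c x. f (sc c x) = c * f x)}"

text \<open>
  The dual carries the operator norm \<^const>\<open>onorm\<close>. An element of the bidual is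
  a function on all of \<open>'a \<Rightarrow> 'k\<close>, of which only the values on the dual matter.
\<close>

definition bidual_over ::
    "('k::real_normed_field \<Rightarrow> 'a::real_normed_vector \<Rightarrow> 'a) \<Rightarrow> (('a \<Rightarrow> 'k) \<Rightarrow> 'k) set"
  where "bidual_over sc = {\<phi>.
    (\<forall>f\<in>dual_over sc. \<forall>g\<in>dual_over sc. \<phi> (\<lambda>x. f x + g x) = \<phi> f + \<phi> g) \<and>
    (\<forall>c. \<forall>f\<in>dual_over sc. \<phi> (\<lambda>x. c * f x) = c * \<phi> f) \<and>
    (\<exists>B. \<forall>f\<in>dual_over sc. norm (\<phi> f) \<le> B * onorm f)}"

text \<open>Surjectivity of the canonical embedding into the bidual.\<close>

definition reflexive_over ::
    "('k::real_normed_field \<Rightarrow> 'a::real_normed_vector \<Rightarrow> 'a) \<Rightarrow> bool"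
  where "reflexive_over sc \<longleftrightarrow>
    (\<forall>\<phi>\<in>bidual_over sc. \<exists>x. \<forall>f\<in>dual_over sc. \<phi> f = f x)"

text \<open>
  A complex inner product, linear in the first argument, that induces the norm of the type.
  For a complete type this makes it a complex Hilbert space.
\<close>

locale complex_inner_space = normed_space_over sc
  for sc :: "complex \<Rightarrow> 'a::real_normed_vector \<Rightarrow> 'a" +
  fixes ip :: "'a \<Rightarrow> 'a \<Rightarrow> complex"
  assumes ip_add_left: "ip (x + y) z = ip x z + ip y z"
    and ip_scale_left: "ip (sc c x) y = c * ip x y"
    and ip_commute: "ip y x = cnj (ip x y)"
    and ip_self: "ip x x = of_real ((norm x)\<^sup>2)"

lemma complex_inner_space_complex: "complex_inner_space (*) (\<lambda>x y. x * cnj y)"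
  by unfold_locales
     (auto simp: algebra_simps norm_mult scaleR_conv_of_real complex_norm_square simp del: of_real_power)

text \<open>
  An operator is a domain \<open>D\<close> together with a function \<open>T\<close> whose values outside \<open>D\<close>
  play no role.
\<close>

definition operator_in :: "('k::field \<Rightarrow> 'a::ab_group_add \<Rightarrow> 'a) \<Rightarrow> 'a set \<Rightarrow> ('a \<Rightarrow> 'a) \<Rightarrow> bool"
  where "operator_in sc D T \<longleftrightarrow> module.subspace sc D \<and>
    (\<forall>x\<in>D. \<forall>y\<in>D. T (x + y) = T x + T y) \<and>
    (\<forall>c. \<forall>x\<in>D. T (sc c x) = sc c (T x))"

definition closed_operator ::
    "('k::field \<Rightarrow> 'a::real_normed_vector \<Rightarrow> 'a) \<Rightarrow> 'a set \<Rightarrow> ('a \<Rightarrow> 'a) \<Rightarrow> bool"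
  where "closed_operator sc D T \<longleftrightarrow> operator_in sc D T \<and> closed {(x, T x) |x. x \<in> D}"

definition point_spectrum ::
    "('k::field \<Rightarrow> 'a::ab_group_add \<Rightarrow> 'a) \<Rightarrow> 'a set \<Rightarrow> ('a \<Rightarrow> 'a) \<Rightarrow> 'k set"
  where "point_spectrum sc D T = {l. {x \<in> D. T x - sc l x = 0} \<noteq> {0}}"

end

theory Submission
  imports Defs
begin

text \<open>
  Cover \<open>X - {0}\<close> by countably many closed balls \<open>B\<close> that avoid 0. The eigenvalues with an
  eigenvector in \<open>B\<close> form a closed set: let \<open>T x\<^sub>n = c\<^sub>n x\<^sub>n\<close> with \<open>x\<^sub>n\<close> in \<open>B\<close> and
  \<open>c\<^sub>n\<close> tending to \<open>c\<close>. The closed convex hulls of the tails of \<open>x\<^sub>n\<close> have a common point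
  \<open>z\<close>, by reflexivity. Convex combinations of late \<open>x\<^sub>n\<close> are approximate eigenvectors for
  \<open>c\<close>, so that \<open>T z = c z\<close> since \<open>T\<close> is closed.

  The common point comes from weak compactness, in the form of a limit along a filter, and from
  separation by a minimal sublinear functional; in a Hilbert space it is the limit of points of
  almost minimal norm.
\<close>

section \<open>Separation of points from closed convex sets\<close>

definition sublinear :: "('a::real_vector \<Rightarrow> real) \<Rightarrow> bool"
  where "sublinear q \<longleftrightarrow>
    (\<forall>x y. q (x + y) \<le> q x + q y) \<and> (\<forall>r\<ge>0. \<forall>x. q (r *\<^sub>R x) = r * q x)"

lemma sublinear_add: "sublinear q \<Longrightarrow> q (x + y) \<le> q x + q y"
  and sublinear_scale: "sublinear q \<Longrightarrow> 0 \<le> r \<Longrightarrow> q (r *\<^sub>R x) = r * q x"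
  by (auto simp: sublinear_def)

lemma sublinear_zero: "sublinear q \<Longrightarrow> q 0 = 0"
  using sublinear_scale[of q 0 0] by simp

lemma sublinear_lower:
  assumes "sublinear q"
  shows "- q (- x) \<le> q x"
  using sublinear_add[OF assms, of x "- x"] sublinear_zero[OF assms] by simp

text \<open>The reverse of \<open>scale\<close> comes from \<open>scale\<close> itself, used with
  \<open>inverse r\<close> at the point \<open>r *\<^sub>R x\<close>.\<close>

lemma sublinearI:
  assumes zero: "q 0 = 0"
    and add: "\<And>x y. q (x + y) \<le> q x + q y"
    and scale: "\<And>r x. 0 < r \<Longrightarrow> q (r *\<^sub>R x) \<le> r * q x"
  shows "sublinear q"
  unfolding sublinear_def
proof (intro conjI allI impI)
  fix r :: real and x assume "0 \<le> r"
  show "q (r *\<^sub>R x) = r * q x"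
  proof (cases "r = 0")
    case False
    with \<open>0 \<le> r\<close> have r: "0 < r" by simp
    have "q x \<le> inverse r * q (r *\<^sub>R x)"
      using scale[of "inverse r" "r *\<^sub>R x"] r by simp
    then have "r * q x \<le> q (r *\<^sub>R x)"
      using r by (simp add: field_simps)
    with scale[OF r] show ?thesis by (simp add: antisym)
  qed (simp add: zero)
qed (rule add)

lemma sublinear_norm: "sublinear norm"
  by (rule sublinearI) (auto simp: norm_triangle_ineq)

text \<open>The infimum of \<open>q (z + t *\<^sub>R y) - t * d\<close> is the largest sublinear
  functional below \<open>q\<close> with \<open>p (- y) \<le> - d\<close> on \<open>K\<close>. A
  linear functional below \<open>p\<close> is then at least \<open>d\<close> on \<open>K\<close>.
  Singletons \<open>K\<close> serve the Hahn-Banach theorem, translated convex sets serve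
  separation.\<close>

lemma sublinear_minorant:
  fixes q :: "'a::real_vector \<Rightarrow> real"
  assumes q: "sublinear q" and K: "convex K" "K \<noteq> {}" and d: "\<And>y. y \<in> K \<Longrightarrow> d \<le> q y"
  obtains p where "sublinear p" "p \<le> q" "\<forall>y\<in>K. p (- y) \<le> - d"
proof -
  define p where "p z = (INF (t, y) \<in> {0..} \<times> K. q (z + t *\<^sub>R y) - t * d)" for z
  \<comment> \<open>This bound is free of \<open>t\<close> and \<open>y\<close>, so the infimum
    defining \<open>p\<close> is finite.\<close>
  have lower: "- q (- z) \<le> q (z + t *\<^sub>R y) - t * d" if "0 \<le> t" "y \<in> K" for z t y
  proof -
    have "t * d \<le> q (t *\<^sub>R y)"
      using d[OF that(2)] that(1) by (simp add: sublinear_scale[OF q] mult_left_mono)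
    also have "\<dots> \<le> q (z + t *\<^sub>R y) + q (- z)"
      using sublinear_add[OF q, of "z + t *\<^sub>R y" "- z"] by simp
    finally show ?thesis by simp
  qed
  have p_le: "p z \<le> q (z + t *\<^sub>R y) - t * d" if "0 \<le> t" "y \<in> K" for z t y
  proof -
    have "bdd_below ((\<lambda>(t, y). q (z + t *\<^sub>R y) - t * d) ` ({0..} \<times> K))"
      using lower by (intro bdd_belowI[of _ "- q (- z)"]) auto
    from cINF_lower[OF this, of "(t, y)"] that show ?thesis
      by (simp add: p_def)
  qed
  have p_ge: "c \<le> p z" if "\<And>t y. 0 \<le> t \<Longrightarrow> y \<in> K \<Longrightarrow> c \<le> q (z + t *\<^sub>R y) - t * d" for c z
    unfolding p_def using K(2) that by (intro cINF_greatest) auto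
  obtain k where k: "k \<in> K" using K(2) by auto
  have "sublinear p"
  proof (rule sublinearI)
    have "p 0 \<le> 0"
      using p_le[of 0 k 0] k sublinear_zero[OF q] by simp
    moreover have "0 \<le> p 0"
      using lower[of _ _ 0] sublinear_zero[OF q] by (intro p_ge) simp
    ultimately show "p 0 = 0" by simp
  next
    fix x y
    have combine: "p (x + y) \<le> (q (x + s *\<^sub>R a) - s * d) + (q (y + t *\<^sub>R b) - t * d)"
      if st: "0 \<le> s" "0 \<le> t" and ab: "a \<in> K" "b \<in> K" for s t a b
    proof -
      \<comment> \<open>Convexity merges the two shifts: \<open>c\<close> is the mean of
        \<open>a\<close> and \<open>b\<close> with weights proportional to \<open>s\<close> and
        \<open>t\<close>, or any point of \<open>K\<close> if both weights vanish.\<close>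
      obtain c where c: "c \<in> K" "(s + t) *\<^sub>R c = s *\<^sub>R a + t *\<^sub>R b"
      proof (cases "s + t = 0")
        case True
        with st have "s = 0" "t = 0" by auto
        with k that show ?thesis by simp
      next
        case False
        with st have "s + t > 0" by simp
        then have "(s / (s + t)) *\<^sub>R a + (t / (s + t)) *\<^sub>R b \<in> K"
          using st ab by (intro convexD[OF K(1)]) (auto simp: add_divide_distrib[symmetric])
        moreover have "(s + t) *\<^sub>R ((s / (s + t)) *\<^sub>R a + (t / (s + t)) *\<^sub>R b) = s *\<^sub>R a + t *\<^sub>R b"
          using False by (simp add: scaleR_add_right)
        ultimately show ?thesis using that by blast
      qed
      have "p (x + y) \<le> q (x + y + (s + t) *\<^sub>R c) - (s + t) * d"
        using st c(1) by (intro p_le) auto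
      also have "x + y + (s + t) *\<^sub>R c = (x + s *\<^sub>R a) + (y + t *\<^sub>R b)"
        using c(2) by (simp add: algebra_simps)
      finally show ?thesis
        using sublinear_add[OF q, of "x + s *\<^sub>R a" "y + t *\<^sub>R b"] by (simp add: algebra_simps)
    qed
    \<comment> \<open>The two infima are taken one after the other: first over \<open>s\<close> and
      \<open>a\<close>, then over \<open>t\<close> and \<open>b\<close>.\<close>
    have "p (x + y) - p x \<le> q (y + t *\<^sub>R b) - t * d" if "0 \<le> t" "b \<in> K" for t b
    proof -
      have "p (x + y) - (q (y + t *\<^sub>R b) - t * d) \<le> p x"
        using combine[OF _ that(1) _ that(2)] by (intro p_ge) (simp add: algebra_simps)
      then show ?thesis by simp
    qed
    then have "p (x + y) - p x \<le> p y" by (intro p_ge)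
    then show "p (x + y) \<le> p x + p y" by simp
  next
    fix r :: real and x assume r: "0 < r"
    have "inverse r * p (r *\<^sub>R x) \<le> p x"
    proof (rule p_ge)
      fix t :: real and y assume "0 \<le> t" "y \<in> K"
      then have "p (r *\<^sub>R x) \<le> q (r *\<^sub>R x + (r * t) *\<^sub>R y) - (r * t) * d"
        using r by (intro p_le) auto
      also have "r *\<^sub>R x + (r * t) *\<^sub>R y = r *\<^sub>R (x + t *\<^sub>R y)"
        by (simp add: algebra_simps)
      also have "q \<dots> - (r * t) * d = r * (q (x + t *\<^sub>R y) - t * d)"
        using r by (simp add: sublinear_scale[OF q] right_diff_distrib)
      finally show "inverse r * p (r *\<^sub>R x) \<le> q (x + t *\<^sub>R y) - t * d"
        using r by (simp add: field_simps)
    qed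
    then show "p (r *\<^sub>R x) \<le> r * p x"
      using r by (simp add: field_simps)
  qed
  moreover have "p \<le> q"
    using p_le[of 0 k] k by (auto simp: le_fun_def)
  moreover have "p (- y) \<le> - d" if "y \<in> K" for y
    using p_le[of 1 y "- y"] that sublinear_zero[OF q] by simp
  ultimately show ?thesis using that by blast
qed

text \<open>Zorn's lemma gives a minimal sublinear functional below \<open>q\<close>. Lowering it at
  a single point by \<open>sublinear_minorant\<close> cannot change it, which makes it odd and hence
  linear.\<close>

theorem Hahn_Banach_sublinear:
  fixes q :: "'a::real_vector \<Rightarrow> real"
  assumes q: "sublinear q"
  obtains f where "linear f" "\<And>x. f x \<le> q x"
proof -
  define A where "A = {p. sublinear p \<and> p \<le> q}"
  \<comment> \<open>The order is reversed, so that a maximal element for \<open>P\<close> is a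
    minimal functional.\<close>
  define P :: "('a \<Rightarrow> real) \<Rightarrow> ('a \<Rightarrow> real) \<Rightarrow> bool" where "P a b \<longleftrightarrow> b \<le> a" for a b
  have "\<exists>m\<in>A. \<forall>a\<in>A. P m a \<longrightarrow> a = m"
  proof (rule predicate_Zorn)
    show "partial_order_on A (relation_of P A)"
      by (rule partial_order_on_relation_ofI) (auto simp: P_def)
  next
    fix C assume "C \<in> Chains (relation_of P A)"
    then have CA: "C \<subseteq> A" and chain: "\<And>a b. a \<in> C \<Longrightarrow> b \<in> C \<Longrightarrow> a \<le> b \<or> b \<le> a"
      by (auto simp: Chains_def relation_of_def P_def)
    show "\<exists>u\<in>A. \<forall>a\<in>C. P a u"
    proof (cases "C = {}")
      case True
      then show ?thesis using q by (auto simp: A_def)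
    next
      case False
      \<comment> \<open>The pointwise infimum bounds a nonempty chain; it is finite because every
        member is at least \<open>- q (- x)\<close> at \<open>x\<close>.\<close>
      define u where "u x = (INF a\<in>C. a x)" for x
      have sub: "sublinear a" and le_q: "a x \<le> q x" if "a \<in> C" for a x
        using that CA by (auto simp: A_def le_fun_def)
      have "- q (- x) \<le> a x" if "a \<in> C" for a x
        using sublinear_lower[OF sub[OF that], of x] le_q[OF that, of "- x"] by linarith
      then have "bdd_below ((\<lambda>a. a x) ` C)" for x
        by (intro bdd_belowI[of _ "- q (- x)"]) auto
      then have u_le: "u x \<le> a x" if "a \<in> C" for a x
        unfolding u_def using that by (intro cINF_lower)
      have u_ge: "c \<le> u x" if "\<And>a. a \<in> C \<Longrightarrow> c \<le> a x" for c x
        unfolding u_def using False that by (intro cINF_greatest)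
      have "sublinear u"
      proof (rule sublinearI)
        have "(\<lambda>a. a 0) ` C = {0}"
          using False sublinear_zero[OF sub] by force
        then show "u 0 = 0" by (simp add: u_def)
      next
        fix x y
        \<comment> \<open>Of two members of the chain, the pointwise smaller one bounds
          \<open>u (x + y)\<close> through its own subadditivity.\<close>
        have combine: "u (x + y) \<le> a x + b y" if ab: "a \<in> C" "b \<in> C" for a b
          using chain[OF ab]
        proof
          assume "a \<le> b"
          then have "a y \<le> b y" by (simp add: le_fun_def)
          then show ?thesis
            using u_le[OF ab(1), of "x + y"] sublinear_add[OF sub[OF ab(1)], of x y] by linarith
        next
          assume "b \<le> a"
          then have "b x \<le> a x" by (simp add: le_fun_def)
          then show ?thesis
            using u_le[OF ab(2), of "x + y"] sublinear_add[OF sub[OF ab(2)], of x y] by linarith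
        qed
        have "u (x + y) - u x \<le> b y" if "b \<in> C" for b
        proof -
          have "u (x + y) - b y \<le> u x"
            using combine[OF _ that] by (intro u_ge) (simp add: algebra_simps)
          then show ?thesis by simp
        qed
        then have "u (x + y) - u x \<le> u y" by (intro u_ge)
        then show "u (x + y) \<le> u x + u y" by simp
      next
        fix r :: real and x assume r: "0 < r"
        have "inverse r * u (r *\<^sub>R x) \<le> u x"
        proof (rule u_ge)
          fix a assume a: "a \<in> C"
          then show "inverse r * u (r *\<^sub>R x) \<le> a x"
            using u_le[OF a, of "r *\<^sub>R x"] r by (simp add: sublinear_scale[OF sub] field_simps)
        qed
        then show "u (r *\<^sub>R x) \<le> r * u x"
          using r by (simp add: field_simps)
      qed
      moreover have "u \<le> q"
      proof -
        obtain a where "a \<in> C" using False by blast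
        then show ?thesis
          using u_le le_q unfolding le_fun_def by (blast intro: order_trans)
      qed
      moreover have "P a u" if "a \<in> C" for a
        using u_le[OF that] by (simp add: P_def le_fun_def)
      ultimately show ?thesis by (auto simp: A_def)
    qed
  qed
  then obtain m where "m \<in> A" and maximal: "\<And>a. a \<in> A \<Longrightarrow> P m a \<Longrightarrow> a = m"
    by blast
  then have m: "sublinear m" "m \<le> q"
    by (simp_all add: A_def)
  have minimal: "p = m" if "sublinear p" "p \<le> m" for p
    using maximal[of p] that order_trans[OF that(2) m(2)] by (simp add: A_def P_def)
  have neg: "m (- x) = - m x" for x
  proof -
    \<comment> \<open>For \<open>K = {x}\<close> and \<open>d = m x\<close> the minorant equals
      \<open>m\<close> by minimality.\<close>
    obtain p where p: "sublinear p" "p \<le> m" "p (- x) \<le> - m x"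
      by (rule sublinear_minorant[OF m(1), of "{x}" "m x"]) auto
    then have "m (- x) \<le> - m x"
      using minimal[OF p(1,2)] by simp
    then show ?thesis
      using sublinear_lower[OF m(1), of x] by simp
  qed
  have add: "m (x + y) = m x + m y" for x y
    using sublinear_add[OF m(1), of x y] sublinear_add[OF m(1), of "x + y" "- y"] neg[of y] by simp
  have scale: "m (r *\<^sub>R x) = r * m x" for r x
  proof (cases "0 \<le> r")
    case False
    then have "m ((- r) *\<^sub>R x) = (- r) * m x"
      by (intro sublinear_scale[OF m(1)]) simp
    then show ?thesis using neg[of "r *\<^sub>R x"] by simp
  qed (rule sublinear_scale[OF m(1)])
  have "linear m"
    by (rule linearI) (auto simp: add scale)
  with m(2) show ?thesis by (auto simp: le_fun_def intro: that)
qed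

text \<open>On the translate of \<open>C\<close> by \<open>- x\<close> the norm is at least the
  distance \<open>infdist x C\<close>. A linear functional below the corresponding minorant of the
  norm is at least that distance there, and it is bounded since it lies below the norm.\<close>

theorem separating_functional:
  fixes C :: "'a::real_normed_vector set"
  assumes C: "convex C" "closed C" "C \<noteq> {}" and x: "x \<notin> C"
  obtains f :: "'a \<Rightarrow> real" and d
    where "bounded_linear f" "0 < d" "\<And>y. y \<in> C \<Longrightarrow> f x + d \<le> f y"
proof -
  define d where "d = infdist x C"
  have d: "0 < d"
    using in_closed_iff_infdist_zero[OF C(2,3), of x] x infdist_nonneg[of x C] by (simp add: d_def less_le)
  have "convex ((\<lambda>y. y - x) ` C)"
    using C(1) by simp
  moreover have "(\<lambda>y. y - x) ` C \<noteq> {}"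
    using C(3) by simp
  moreover have "d \<le> norm z" if "z \<in> (\<lambda>y. y - x) ` C" for z
    using that infdist_le[of _ C x] by (auto simp: d_def dist_norm norm_minus_commute)
  ultimately obtain p where p: "sublinear p" "p \<le> norm"
    "\<forall>z\<in>(\<lambda>y. y - x) ` C. p (- z) \<le> - d"
    by (rule sublinear_minorant[OF sublinear_norm]) blast
  obtain f where f: "linear f" "\<And>z. f z \<le> p z"
    using Hahn_Banach_sublinear[OF p(1)] by blast
  have f_le: "f z \<le> norm z" for z
    using order_trans[OF f(2) le_funD[OF p(2)]] .
  have "norm (f z) \<le> norm z * 1" for z
    using f_le[of z] f_le[of "- z"] linear_neg[OF f(1), of z] by simp
  then have "bounded_linear f"
    using f(1) by (intro bounded_linear_intro[of f 1]) (auto simp: linear_add linear_scale)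
  moreover have "f x + d \<le> f y" if "y \<in> C" for y
    using f(2)[of "- (y - x)"] bspec[OF p(3), of "y - x"] that linear_diff[OF f(1), of x y] by simp
  ultimately show ?thesis using d that by blast
qed

section \<open>Nested intersections of bounded closed convex sets\<close>

text \<open>By a theorem of Smulian this property characterizes reflexivity.\<close>

definition nested_convex_property :: "'a::real_normed_vector itself \<Rightarrow> bool"
  where "nested_convex_property _ \<longleftrightarrow>
    (\<forall>C :: nat \<Rightarrow> 'a set.
      (\<forall>n. convex (C n) \<and> closed (C n) \<and> bounded (C n) \<and> C n \<noteq> {}) \<and> decseq C \<longrightarrow>
      (\<Inter>n. C n) \<noteq> {})"

section \<open>Weak limits along filters\<close>

text \<open>By Tychonoff's theorem the points \<open>\<lambda>i. u i k\<close> of a product of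
  compact sets cluster at some \<open>l\<close>. With many indices a subsequence converging in every
  coordinate need not exist, so a filter finer than \<open>sequentially\<close> takes its
  place.\<close>

lemma common_convergence_filter:
  fixes u :: "'i \<Rightarrow> nat \<Rightarrow> 'k::heine_borel"
  assumes bounded: "\<And>i. bounded (range (u i))"
  obtains H l where "H \<noteq> bot" "H \<le> sequentially" "\<And>i. (u i \<longlongrightarrow> l i) H"
proof -
  define S where "S = (\<Pi>\<^sub>E i\<in>UNIV. closure (range (u i)))"
  define g where "g k = (\<lambda>i. u i k)" for k
  have "compactin (product_topology (\<lambda>i. euclidean) UNIV) S"
    unfolding S_def compactin_PiE by (simp add: bounded compact_closure)
  then have "compact S"
    by (simp add: euclidean_product_topology)
  moreover have "filtermap g sequentially \<noteq> bot"
    by (simp add: filtermap_bot_iff)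
  moreover have "g k \<in> S" for k
    using closure_subset by (fastforce simp: S_def g_def)
  then have "eventually (\<lambda>x. x \<in> S) (filtermap g sequentially)"
    by (simp add: eventually_filtermap)
  ultimately obtain l where l: "inf (nhds l) (filtermap g sequentially) \<noteq> bot"
    unfolding compact_filter by blast
  define H where "H = inf (filtercomap g (nhds l)) sequentially"
  \<comment> \<open>If \<open>H\<close> were trivial, \<open>g\<close> would eventually avoid a
    neighbourhood of \<open>l\<close>, contrary to the choice of \<open>l\<close>.\<close>
  have "H \<noteq> bot"
  proof
    assume "H = bot"
    then have "eventually (\<lambda>_. False) H" by simp
    then obtain Q R where Q: "eventually Q (filtercomap g (nhds l))" and R: "eventually R sequentially"
      and QR: "\<And>k. Q k \<Longrightarrow> R k \<Longrightarrow> False"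
      unfolding H_def eventually_inf by blast
    from Q obtain Q' where Q': "eventually Q' (nhds l)" "\<And>k. Q' (g k) \<Longrightarrow> Q k"
      by (auto simp: eventually_filtercomap)
    have "eventually (\<lambda>x. \<not> Q' x) (filtermap g sequentially)"
      unfolding eventually_filtermap using R by eventually_elim (use Q' QR in blast)
    with Q'(1) have "eventually (\<lambda>_. False) (inf (nhds l) (filtermap g sequentially))"
      unfolding eventually_inf by blast
    with l show False by simp
  qed
  moreover have "H \<le> sequentially"
    by (simp add: H_def)
  moreover have "(u i \<longlongrightarrow> l i) H" for i
  proof -
    have "filterlim g (nhds l) (filtercomap g (nhds l))"
      by (simp add: filterlim_def filtermap_filtercomap)
    then have "(g \<longlongrightarrow> l) H"
      by (rule tendsto_mono[rotated]) (simp add: H_def)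
    then have "((\<lambda>k. g k i) \<longlongrightarrow> l i) H"
      by (rule continuous_on_tendsto_compose[OF continuous_on_product_coordinates]) auto
    then show ?thesis by (simp add: g_def)
  qed
  ultimately show ?thesis using that by blast
qed

text \<open>Limits of \<open>f (x k)\<close> with \<open>x k\<close> in \<open>C k\<close> define an
  element of the bidual; reflexivity represents it by a point \<open>z\<close>, and separation puts
  \<open>z\<close> into every \<open>C n\<close>. Separating functionals are only real-linear:
  \<open>complexify\<close> writes them as \<open>re\<close> of dual elements, where
  \<open>re\<close> will be the identity or the real part.\<close>

theorem reflexive_imp_nested_convex_property:
  fixes sc :: "'k::{real_normed_field, heine_borel} \<Rightarrow> 'a::real_normed_vector \<Rightarrow> 'a"
  assumes refl: "reflexive_over sc"
    and re: "bounded_linear re"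
    and complexify: "\<And>u::'a \<Rightarrow> real. bounded_linear u \<Longrightarrow> \<exists>f\<in>dual_over sc. u = (\<lambda>x. re (f x))"
  shows "nested_convex_property TYPE('a)"
  unfolding nested_convex_property_def
proof (intro allI impI, elim conjE)
  fix C :: "nat \<Rightarrow> 'a set"
  assume "\<forall>n. convex (C n) \<and> closed (C n) \<and> bounded (C n) \<and> C n \<noteq> {}" and dec: "decseq C"
  then have C: "convex (C n)" "closed (C n)" "bounded (C n)" "C n \<noteq> {}" for n by auto
  have "\<forall>n. \<exists>y. y \<in> C n"
    using C(4) by blast
  then obtain x where x: "\<And>n. x n \<in> C n" by metis
  obtain M where M: "\<And>y. y \<in> C 0 \<Longrightarrow> norm y \<le> M"
    using C(3)[of 0] bounded_iff by blast
  have xC: "x k \<in> C n" if "n \<le> k" for n k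
    using x[of k] decseqD[OF dec that] by blast
  have xM: "norm (x k) \<le> M" for k
    using M xC[of 0 k] by simp
  \<comment> \<open>The value 0 off the dual keeps every sequence \<open>u f\<close> bounded, as
    \<open>common_convergence_filter\<close> asks of all indices.\<close>
  define u where "u f k = (if f \<in> dual_over sc then f (x k) else 0)" for f k
  have u_le: "norm (f (x k)) \<le> M * onorm f" if "f \<in> dual_over sc" for f k
  proof -
    have f: "bounded_linear f" using that by (simp add: dual_over_def)
    show ?thesis
      using onorm[OF f, of "x k"] mult_left_mono[OF xM[of k] onorm_pos_le[OF f]]
      by (simp add: mult.commute)
  qed
  have "bounded (range (u f))" for f
  proof (cases "f \<in> dual_over sc")
    case True
    then show ?thesis
      using u_le by (intro boundedI[of _ "M * onorm f"]) (auto simp: u_def)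
  qed (simp add: u_def)
  then obtain H \<phi> where H: "H \<noteq> bot" "H \<le> sequentially" and lim: "\<And>f. (u f \<longlongrightarrow> \<phi> f) H"
    using common_convergence_filter[of u] by blast
  have \<phi>: "((\<lambda>k. f (x k)) \<longlongrightarrow> \<phi> f) H" if "f \<in> dual_over sc" for f
  proof -
    have "u f = (\<lambda>k. f (x k))"
      using that by (simp add: u_def fun_eq_iff)
    then show ?thesis using lim[of f] by simp
  qed
  have "\<phi> \<in> bidual_over sc"
    unfolding bidual_over_def
  proof (intro CollectI conjI ballI allI)
    fix f g assume f: "f \<in> dual_over sc" and g: "g \<in> dual_over sc"
    then have "(\<lambda>x. f x + g x) \<in> dual_over sc"
      by (auto simp: dual_over_def bounded_linear_add distrib_left)
    from \<phi>[OF this] show "\<phi> (\<lambda>x. f x + g x) = \<phi> f + \<phi> g"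
      by (rule tendsto_unique[OF H(1) _ tendsto_add[OF \<phi>[OF f] \<phi>[OF g]]])
  next
    fix c f assume f: "f \<in> dual_over sc"
    then have "(\<lambda>x. c * f x) \<in> dual_over sc"
      by (auto simp: dual_over_def bounded_linear_const_mult mult.left_commute)
    from \<phi>[OF this] show "\<phi> (\<lambda>x. c * f x) = c * \<phi> f"
      by (rule tendsto_unique[OF H(1) _ tendsto_mult_left[OF \<phi>[OF f]]])
  next
    have "norm (\<phi> f) \<le> M * onorm f" if "f \<in> dual_over sc" for f
      by (rule tendsto_upperbound[OF tendsto_norm[OF \<phi>[OF that]] _ H(1)])
        (simp add: u_le[OF that])
    then show "\<exists>B. \<forall>f\<in>dual_over sc. norm (\<phi> f) \<le> B * onorm f" by blast
  qed
  then obtain z where z: "\<And>f. f \<in> dual_over sc \<Longrightarrow> \<phi> f = f z"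
    using refl unfolding reflexive_over_def by blast
  have "z \<in> C n" for n
  proof (rule ccontr)
    assume "z \<notin> C n"
    then obtain v :: "'a \<Rightarrow> real" and d where v: "bounded_linear v" and d: "0 < d"
      and sep: "\<And>y. y \<in> C n \<Longrightarrow> v z + d \<le> v y"
      using separating_functional[OF C(1,2,4)] by blast
    obtain f where f: "f \<in> dual_over sc" and vf: "v = (\<lambda>x. re (f x))"
      using complexify[OF v] by blast
    have "((\<lambda>k. v (x k)) \<longlongrightarrow> v z) H"
      using bounded_linear.tendsto[OF re \<phi>[OF f]] by (simp add: z[OF f] vf)
    \<comment> \<open>Along \<open>H\<close> only indices \<open>k\<close> with
      \<open>n \<le> k\<close> matter, and for these \<open>x k\<close> lies in
      \<open>C n\<close>.\<close>
    moreover have "eventually (\<lambda>k. n \<le> k) H"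
      using H(2) eventually_ge_at_top by (rule filter_leD)
    then have "eventually (\<lambda>k. v z + d \<le> v (x k)) H"
      by eventually_elim (use sep xC in blast)
    ultimately have "v z + d \<le> v z"
      using H(1) by (rule tendsto_lowerbound)
    with d show False by simp
  qed
  then show "(\<Inter>n. C n) \<noteq> {}" by blast
qed

text \<open>The points of \<open>C n\<close> of almost minimal norm form a Cauchy sequence.\<close>

theorem parallelogram_imp_nested_convex_property:
  assumes parallelogram:
    "\<And>x y :: 'a::banach. (norm (x + y))\<^sup>2 + (norm (x - y))\<^sup>2 = 2 * (norm x)\<^sup>2 + 2 * (norm y)\<^sup>2"
  shows "nested_convex_property TYPE('a)"
  unfolding nested_convex_property_def
proof (intro allI impI, elim conjE)
  fix C :: "nat \<Rightarrow> 'a set"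
  assume "\<forall>n. convex (C n) \<and> closed (C n) \<and> bounded (C n) \<and> C n \<noteq> {}" and dec: "decseq C"
  then have C: "convex (C n)" "closed (C n)" "bounded (C n)" "C n \<noteq> {}" for n by auto
  define \<delta> where "\<delta> n = inverse (real (Suc n))" for n
  \<comment> \<open>The squared distance of \<open>C n\<close> from 0. It increases with
    \<open>n\<close> since the sets shrink, and it stays bounded since \<open>C 0\<close> is
    bounded.\<close>
  define r where "r n = (INF y\<in>C n. (norm y)\<^sup>2)" for n
  have bdd: "bdd_below ((\<lambda>y. (norm y)\<^sup>2) ` C n)" for n
    by (intro bdd_belowI[of _ 0]) auto
  have r_le: "r n \<le> (norm y)\<^sup>2" if "y \<in> C n" for n y
    unfolding r_def using bdd that by (rule cINF_lower)
  have "\<exists>y\<in>C n. (norm y)\<^sup>2 < r n + \<delta> n" for n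
  proof -
    have "r n < r n + \<delta> n" by (simp add: \<delta>_def)
    then show ?thesis
      unfolding r_def by (subst (asm) cINF_less_iff[OF C(4) bdd]) auto
  qed
  then obtain x where x: "\<And>n. x n \<in> C n" "\<And>n. (norm (x n))\<^sup>2 < r n + \<delta> n"
    by metis
  have xC: "x k \<in> C n" if "n \<le> k" for n k
    using x(1)[of k] decseqD[OF dec that] by blast
  obtain M where M: "\<And>y. y \<in> C 0 \<Longrightarrow> norm y \<le> M"
    using C(3)[of 0] bounded_iff by blast
  have "incseq r"
    unfolding incseq_def r_def using dec C(4) bdd
    by (auto intro!: cINF_superset_mono dest: decseqD)
  moreover have "r n \<le> M\<^sup>2" for n
    using r_le[OF x(1)] M[OF xC[of 0 n]] by (meson order_trans power_mono norm_ge_zero zero_le)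
  ultimately obtain L where L: "r \<longlonglongrightarrow> L" "\<And>n. r n \<le> L"
    using incseq_convergent by blast
  define e where "e n = 4 * (L - r n) + 4 * \<delta> n" for n
  \<comment> \<open>The midpoint of \<open>x m\<close> and \<open>x n\<close> lies in
    \<open>C n\<close>, so \<open>(norm (x m + x n))\<^sup>2\<close> is at least
    \<open>4 * r n\<close>; the parallelogram law then leaves little for the difference.\<close>
  have close: "(norm (x m - x n))\<^sup>2 \<le> e n" if "n \<le> m" for m n
  proof -
    have "(1/2) *\<^sub>R x m + (1/2) *\<^sub>R x n \<in> C n"
      using xC[OF that] x(1) by (intro convexD[OF C(1)]) auto
    then have "r n \<le> (norm ((1/2) *\<^sub>R (x m + x n)))\<^sup>2"
      using r_le by (metis scaleR_add_right)
    then have "4 * r n \<le> (norm (x m + x n))\<^sup>2"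
      by (simp add: power_divide)
    moreover have "\<delta> m \<le> \<delta> n"
      using that by (simp add: \<delta>_def)
    ultimately show ?thesis
      using parallelogram[of "x m" "x n"] x(2)[of m] x(2)[of n] L(2)[of m] L(2)[of n]
      unfolding e_def by argo
  qed
  have "e \<longlonglongrightarrow> 4 * (L - L) + 4 * 0"
    unfolding e_def \<delta>_def by (intro tendsto_intros L(1) LIMSEQ_inverse_real_of_nat)
  then have e: "e \<longlonglongrightarrow> 0" by simp
  have "Cauchy x"
    unfolding Cauchy_altdef
  proof (intro allI impI)
    fix \<epsilon> :: real assume \<epsilon>: "0 < \<epsilon>"
    then have "eventually (\<lambda>n. e n < \<epsilon>\<^sup>2) sequentially"
      by (intro order_tendstoD(2)[OF e]) simp
    then obtain N where N: "\<And>n. N \<le> n \<Longrightarrow> e n < \<epsilon>\<^sup>2"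
      by (auto simp: eventually_sequentially)
    have "dist (x m) (x n) < \<epsilon>" if "N \<le> m" "m < n" for m n
    proof -
      have "(norm (x n - x m))\<^sup>2 < \<epsilon>\<^sup>2"
        using close[of m n] N[of m] that by simp
      then show ?thesis
        using \<epsilon> by (metis dist_commute dist_norm less_imp_le power_less_imp_less_base)
    qed
    then show "\<exists>M. \<forall>m\<ge>M. \<forall>n>m. dist (x m) (x n) < \<epsilon>" by blast
  qed
  then obtain z where z: "x \<longlonglongrightarrow> z"
    using Cauchy_convergent convergent_def by blast
  have "z \<in> C n" for n
    by (rule Lim_in_closed_set[OF C(2) _ _ z]) (auto simp: eventually_sequentially intro: xC)
  then show "(\<Inter>n. C n) \<noteq> {}" by blast
qed

section \<open>The point spectrum\<close>

context normed_space_over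
begin

lemma bounded_linear_scale: "bounded_linear (sc c)"
proof (rule bounded_linear_intro)
  show "sc c (r *\<^sub>R x) = r *\<^sub>R sc c x" for r x
    using scale_left_commute[of c "of_real r" x] by (simp only: scale_of_real)
  show "norm (sc c x) \<le> norm x * norm c" for x
    by (simp add: norm_scale mult.commute)
qed (rule scale_right_distrib)

lemma norm_scale_diff: "norm (sc c x - sc d y) \<le> norm (c - d) * norm x + norm d * norm (x - y)"
proof -
  have "sc c x - sc d y = sc (c - d) x + sc d (x - y)"
    by (simp add: scale_left_diff_distrib scale_right_diff_distrib)
  then show ?thesis
    using norm_triangle_ineq[of "sc (c - d) x" "sc d (x - y)"] by (simp only: norm_scale)
qed

text \<open>On \<open>D\<close> the map \<open>T - c\<close> is linear, so the norm of its values is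
  a convex function with convex sublevel sets. Fixing \<open>c\<close> matters: combinations of
  eigenvectors for different eigenvalues need not be eigenvectors.\<close>

lemma convex_approximate_eigenvectors:
  assumes T: "operator_in sc D T"
  shows "convex {y \<in> D. norm (T y - sc c y) \<le> e}"
proof (rule convexI)
  fix x y and s t :: real
  assume xy: "x \<in> {y \<in> D. norm (T y - sc c y) \<le> e}" "y \<in> {y \<in> D. norm (T y - sc c y) \<le> e}"
    and st: "0 \<le> s" "0 \<le> t" "s + t = 1"
  have D: "subspace D" and T_add: "\<And>x y. x \<in> D \<Longrightarrow> y \<in> D \<Longrightarrow> T (x + y) = T x + T y"
    and T_scale: "\<And>c x. x \<in> D \<Longrightarrow> T (sc c x) = sc c (T x)"
    using T by (auto simp: operator_in_def)
  have xD: "x \<in> D" "y \<in> D" using xy by auto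
  have D_scale: "r *\<^sub>R z \<in> D" if "z \<in> D" for r z
    using subspace_scale[OF D that, of "of_real r"] by (simp add: scale_of_real)
  have T_scaleR: "T (r *\<^sub>R z) = r *\<^sub>R T z" if "z \<in> D" for r z
    using T_scale[OF that, of "of_real r"] by (simp add: scale_of_real)
  have sc_scaleR: "sc c (r *\<^sub>R z) = r *\<^sub>R sc c z" for r z
    using scale_left_commute[of c "of_real r" z] by (simp only: scale_of_real)
  have "T (s *\<^sub>R x + t *\<^sub>R y) = s *\<^sub>R T x + t *\<^sub>R T y"
    by (simp only: T_add[OF D_scale D_scale, OF xD] T_scaleR xD)
  moreover have "sc c (s *\<^sub>R x + t *\<^sub>R y) = s *\<^sub>R sc c x + t *\<^sub>R sc c y"
    by (simp only: scale_right_distrib sc_scaleR)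
  ultimately have "T (s *\<^sub>R x + t *\<^sub>R y) - sc c (s *\<^sub>R x + t *\<^sub>R y)
      = s *\<^sub>R (T x - sc c x) + t *\<^sub>R (T y - sc c y)"
    by (simp only: scaleR_right_diff_distrib) simp
  also have "norm \<dots> \<le> s * norm (T x - sc c x) + t * norm (T y - sc c y)"
    using st by (intro norm_triangle_le) simp
  also have "\<dots> \<le> e"
    using xy st by (intro convex_bound_le) auto
  finally show "s *\<^sub>R x + t *\<^sub>R y \<in> {y \<in> D. norm (T y - sc c y) \<le> e}"
    using subspace_add[OF D D_scale D_scale, OF xD] by simp
qed

text \<open>Convexity and closedness of \<open>B\<close> keep the hulls of the tails, and so their
  common point, inside \<open>B\<close>. Boundedness makes the hulls bounded and lets the errors
  \<open>sc (c n - l) (x n)\<close> tend to 0.\<close>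

lemma closed_eigenvalues_convex:
  assumes nested: "nested_convex_property TYPE('a)"
    and T: "closed_operator sc D T"
    and B: "convex B" "closed B" "bounded B"
  shows "closed {c. \<exists>x \<in> D \<inter> B. T x = sc c x}"
  unfolding closed_sequential_limits
proof (intro allI impI, elim conjE)
  fix c l
  assume "\<forall>n. c n \<in> {c. \<exists>x \<in> D \<inter> B. T x = sc c x}" and l: "c \<longlonglongrightarrow> l"
  then have "\<forall>n. \<exists>x. x \<in> D \<and> x \<in> B \<and> T x = sc (c n) x" by blast
  then obtain x where x: "\<And>n. x n \<in> D" "\<And>n. x n \<in> B" "\<And>n. T (x n) = sc (c n) (x n)"
    by metis
  obtain M where M: "0 < M" "\<And>y. y \<in> B \<Longrightarrow> norm y \<le> M"
    using B(3) bounded_pos by blast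
  define C where "C n = closure (convex hull (x ` {n..}))" for n
  have CB: "C n \<subseteq> B" for n
    unfolding C_def using x(2) B by (intro closure_minimal hull_minimal) auto
  have "decseq C"
    unfolding C_def decseq_def by (intro allI impI closure_mono hull_mono image_mono) auto
  moreover have "convex (C n) \<and> closed (C n) \<and> bounded (C n) \<and> C n \<noteq> {}" for n
    using bounded_subset[OF B(3) CB] by (auto simp: C_def convex_closure convex_convex_hull)
  ultimately have "(\<Inter>n. C n) \<noteq> {}"
    using nested by (simp add: nested_convex_property_def)
  then obtain z where z: "\<And>n. z \<in> C n" by blast
  have approx: "\<exists>y\<in>D. norm (y - z) < e \<and> norm (T y - sc l y) \<le> e" if e: "0 < e" for e
  proof -
    \<comment> \<open>The quotient \<open>e / M\<close> compensates for the factor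
      \<open>norm (x n) \<le> M\<close> in the error.\<close>
    have "eventually (\<lambda>n. norm (c n - l) < e / M) sequentially"
      using tendstoD[OF l, of "e / M"] e M(1) by (simp add: dist_norm)
    then obtain N where N: "\<And>n. N \<le> n \<Longrightarrow> norm (c n - l) < e / M"
      by (auto simp: eventually_sequentially)
    have "norm (T (x n) - sc l (x n)) \<le> e" if "N \<le> n" for n
    proof -
      have "norm (T (x n) - sc l (x n)) = norm (c n - l) * norm (x n)"
        by (simp add: x(3) scale_left_diff_distrib[symmetric] norm_scale)
      also have "\<dots> \<le> e / M * M"
        using less_imp_le[OF N[OF that]] M(2)[OF x(2)] M(1) e by (intro mult_mono) simp_all
      finally show ?thesis using M(1) by simp
    qed
    \<comment> \<open>From \<open>N\<close> on, all generators are approximate eigenvectors for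
      \<open>l\<close>, hence so are their convex combinations, and some of these come close to
      \<open>z\<close>.\<close>
    then have "convex hull (x ` {N..}) \<subseteq> {y \<in> D. norm (T y - sc l y) \<le> e}"
      using x(1) T convex_approximate_eigenvectors
      by (intro hull_minimal) (auto simp: closed_operator_def)
    moreover obtain y where "y \<in> convex hull (x ` {N..})" "dist y z < e"
      using z[of N] e unfolding C_def closure_approachable by blast
    ultimately show ?thesis by (auto simp: dist_norm)
  qed
  have "(z, sc l z) \<in> closure {(y, T y) |y. y \<in> D}"
    unfolding closure_approachable
  proof (intro allI impI)
    fix e :: real assume e: "0 < e"
    \<comment> \<open>The first coordinate contributes at most \<open>d\<close> and the second at
      most \<open>(1 + norm l) * d\<close>; the 3 leaves a margin.\<close>
    define d where "d = e / (3 + norm l)"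
    have pos: "0 < 3 + norm l"
      by (simp add: add_pos_nonneg)
    with e have d: "0 < d"
      by (simp add: d_def)
    obtain y where y: "y \<in> D" "norm (y - z) < d" "norm (T y - sc l y) \<le> d"
      using approx[OF d] by blast
    have "dist (y, T y) (z, sc l z) \<le> norm (y - z) + norm (T y - sc l z)"
      unfolding dist_norm using norm_Pair_le[of "y - z" "T y - sc l z"] by simp
    moreover have "norm (T y - sc l z) \<le> d + norm l * d"
    proof -
      have "norm (T y - sc l z) \<le> norm (T y - sc l y) + norm (sc l y - sc l z)"
        using norm_triangle_ineq[of "T y - sc l y" "sc l y - sc l z"] by simp
      also have "norm (sc l y - sc l z) \<le> norm l * d"
        using norm_scale_diff[of l y l z] y(2)
          mult_left_mono[OF less_imp_le[OF y(2)] norm_ge_zero[of l]] by simp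
      finally show ?thesis using y(3) by simp
    qed
    moreover have "d + (d + norm l * d) < (3 + norm l) * d"
      using d by (simp add: algebra_simps)
    moreover have "(3 + norm l) * d = e"
      using pos by (simp add: d_def)
    ultimately have "dist (y, T y) (z, sc l z) < e"
      using y(2) by linarith
    with y(1) show "\<exists>w\<in>{(y, T y) |y. y \<in> D}. dist w (z, sc l z) < e"
      by blast
  qed
  moreover have "closure {(y, T y) |y. y \<in> D} = {(y, T y) |y. y \<in> D}"
    using T by (intro closure_closed) (simp add: closed_operator_def)
  ultimately have "z \<in> D \<and> T z = sc l z" by auto
  then show "l \<in> {c. \<exists>x \<in> D \<inter> B. T x = sc c x}"
    using z[of 0] CB[of 0] by blast
qed

theorem fsigma_point_spectrum:
  assumes nested: "nested_convex_property TYPE('a)"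
    and separable: "separable_space (euclidean :: 'a topology)"
    and T: "closed_operator sc D T"
  shows "fsigma (point_spectrum sc D T)"
proof -
  obtain S :: "'a set" where S: "countable S" "closure S = UNIV"
    using separable
    by (simp only: separable_space_def euclidean_closure_of topspace_euclidean) blast
  \<comment> \<open>Centres in the countable dense set \<open>S\<close> and radii
    \<open>1 / (n + 1)\<close> keep the family of balls countable. \<open>E (a, n)\<close> holds the
    eigenvalues with an eigenvector in the ball of \<open>(a, n)\<close>.\<close>
  define I where "I = {(a, n) \<in> S \<times> (UNIV :: nat set). 0 \<notin> cball a (inverse (Suc n))}"
  define E where "E = (\<lambda>(a, n). {c. \<exists>x \<in> D \<inter> cball a (inverse (Suc n)). T x = sc c x})"
  have "countable I"
  proof (rule countable_subset)
    show "I \<subseteq> S \<times> UNIV" unfolding I_def by blast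
  qed (use S(1) in simp)
  have closed_E: "closed (E i)" for i
  proof (cases i)
    case (Pair a n)
    have "closed {c. \<exists>x \<in> D \<inter> cball a (inverse (Suc n)). T x = sc c x}"
      by (intro closed_eigenvalues_convex[OF nested T] convex_cball closed_cball bounded_cball)
    then show ?thesis by (simp only: E_def Pair prod.case)
  qed
  have op: "operator_in sc D T"
    using T by (simp only: closed_operator_def)
  then have D: "0 \<in> D"
    by (simp only: operator_in_def subspace_0)
  have "\<forall>c. \<forall>x\<in>D. T (sc c x) = sc c (T x)"
    using op unfolding operator_in_def by (elim conjE)
  then have "T (sc 0 0) = sc 0 (T 0)"
    using D by blast
  then have T0: "T 0 = 0" by simp
  \<comment> \<open>As \<open>T 0 = 0\<close>, the kernel contains 0, so differing from
    \<open>{0}\<close> means having a nonzero element.\<close>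
  have "{x \<in> D. T x - sc c x = 0} \<noteq> {0} \<longleftrightarrow> (\<exists>x\<in>D. x \<noteq> 0 \<and> T x = sc c x)" for c
  proof -
    have "0 \<in> {x \<in> D. T x - sc c x = 0}"
      using D T0 by simp
    then have "{x \<in> D. T x - sc c x = 0} \<noteq> {0} \<longleftrightarrow> (\<exists>x\<in>D. x \<noteq> 0 \<and> T x - sc c x = 0)"
      by blast
    then show ?thesis by (simp only: right_minus_eq)
  qed
  then have spectrum: "point_spectrum sc D T = {c. \<exists>x\<in>D. x \<noteq> 0 \<and> T x = sc c x}"
    by (simp only: point_spectrum_def)
  have "\<exists>i\<in>I. c \<in> E i" if x: "x \<in> D" "x \<noteq> 0" "T x = sc c x" for c x
  proof -
    \<comment> \<open>With a radius below \<open>norm x / 2\<close>, a centre closer to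
      \<open>x\<close> than the radius has norm larger than the radius, so the ball contains
      \<open>x\<close> but not 0.\<close>
    obtain n where n: "inverse (real (Suc n)) < norm x / 2"
      using reals_Archimedean[of "norm x / 2"] x(2) by auto
    have "\<forall>e>0. \<exists>a\<in>S. dist a x < e"
      using S(2) by (simp only: closure_approachable[symmetric]) simp
    moreover have "0 < inverse (real (Suc n))" by simp
    ultimately obtain a where a: "a \<in> S" "dist a x < inverse (real (Suc n))"
      by blast
    have "norm x \<le> norm a + dist a x"
      using norm_triangle_ineq[of a "x - a"] by (simp add: dist_norm norm_minus_commute)
    then have "inverse (real (Suc n)) < norm a"
      using a(2) n by linarith
    then have "(a, n) \<in> I"
      using a(1) by (simp add: I_def)
    moreover have "c \<in> E (a, n)"
      using a(2) x by (auto simp: E_def less_imp_le)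
    ultimately show ?thesis by blast
  qed
  moreover have "\<exists>x\<in>D. x \<noteq> 0 \<and> T x = sc c x" if iI: "i \<in> I" and ci: "c \<in> E i" for i c
  proof -
    obtain a n where i: "i = (a, n)" by (rule prod.exhaust)
    have "0 \<notin> cball a (inverse (real (Suc n)))"
      using iI by (simp only: i I_def mem_Collect_eq prod.case simp_thms)
    moreover have "\<exists>x \<in> D \<inter> cball a (inverse (real (Suc n))). T x = sc c x"
      using ci by (simp only: i E_def mem_Collect_eq prod.case)
    then obtain x where x: "x \<in> D" "x \<in> cball a (inverse (real (Suc n)))" "T x = sc c x"
      by (elim bexE IntE)
    ultimately have "x \<noteq> 0" by metis
    with x(1,3) show ?thesis by (intro bexI conjI)
  qed
  ultimately have "(\<exists>x\<in>D. x \<noteq> 0 \<and> T x = sc c x) \<longleftrightarrow> (\<exists>i\<in>I. c \<in> E i)" for c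
    by metis
  then have union: "point_spectrum sc D T = (\<Union>i\<in>I. E i)"
    unfolding spectrum by (intro set_eqI) (simp only: UN_iff mem_Collect_eq)
  \<comment> \<open>An F-sigma set is the union of a sequence of closed sets, so \<open>I\<close> is
    enumerated, possibly with repetitions. In the trivial space \<open>I\<close> is empty.\<close>
  show ?thesis
  proof (cases "I = {}")
    case True
    then have "point_spectrum sc D T = {}" using union by simp
    then show ?thesis using fsigma.intros[of "\<lambda>_. {}"] by simp
  next
    case False
    then have "range (from_nat_into I) = I"
      using \<open>countable I\<close> by (rule range_from_nat_into)
    then have "point_spectrum sc D T = \<Union> (E ` range (from_nat_into I))"
      using union by simp
    also have "\<dots> = (\<Union>n. E (from_nat_into I n))"
      by (simp only: image_image)
    finally show ?thesis
      using fsigma.intros[of "\<lambda>n. E (from_nat_into I n)"] closed_E by simp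
  qed
qed

end

section \<open>Real, complex and Hilbert spaces\<close>

lemma real_reflexive_imp_nested_convex_property:
  assumes "reflexive_over (scaleR :: real \<Rightarrow> 'a::real_normed_vector \<Rightarrow> 'a)"
  shows "nested_convex_property TYPE('a)"
proof (rule reflexive_imp_nested_convex_property[OF assms bounded_linear_ident])
  fix u :: "'a \<Rightarrow> real" assume "bounded_linear u"
  then show "\<exists>f\<in>dual_over scaleR. u = (\<lambda>x. f x)"
    by (auto simp: dual_over_def linear_simps)
qed

text \<open>A real-linear \<open>u\<close> is the real part of the complex-linear functional
  \<open>u x - \<i> * u (sc \<i> x)\<close>.\<close>

lemma complex_reflexive_imp_nested_convex_property:
  fixes sc :: "complex \<Rightarrow> 'a::real_normed_vector \<Rightarrow> 'a"
  assumes "normed_space_over sc" and "reflexive_over sc"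
  shows "nested_convex_property TYPE('a)"
proof (rule reflexive_imp_nested_convex_property[OF assms(2) bounded_linear_Re])
  interpret normed_space_over sc by fact
  fix u :: "'a \<Rightarrow> real" assume u: "bounded_linear u"
  then interpret u: bounded_linear u .
  define f where "f x = complex_of_real (u x) - \<i> * complex_of_real (u (sc \<i> x))" for x
  have "bounded_linear f"
    unfolding f_def
    by (intro bounded_linear_sub bounded_linear_const_mult
        bounded_linear_compose[OF bounded_linear_of_real] u
        bounded_linear_compose[OF u bounded_linear_scale])
  moreover have "f (sc c x) = c * f x" for c x
  proof -
    have decompose: "sc c y = Re c *\<^sub>R y + Im c *\<^sub>R sc \<i> y" for c y
    proof -
      have "sc c y = sc (of_real (Re c) + of_real (Im c) * \<i>) y"
        by (simp add: complex_eq mult.commute)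
      also have "\<dots> = Re c *\<^sub>R y + Im c *\<^sub>R sc \<i> y"
        by (simp only: scale_left_distrib scale_scale[symmetric] scale_of_real)
      finally show ?thesis .
    qed
    \<comment> \<open>Splitting \<open>c\<close> and \<open>\<i> * c\<close> into real and imaginary
      parts reduces both sides to the values of \<open>u\<close> at \<open>x\<close> and
      \<open>sc \<i> x\<close>.\<close>
    have "sc \<i> (sc c x) = sc (\<i> * c) x" by simp
    then show ?thesis
      by (simp add: f_def decompose[of c] decompose[of "\<i> * c"] u.add u.scaleR u.diff u.neg complex_eq_iff)
  qed
  ultimately show "\<exists>f\<in>dual_over sc. u = (\<lambda>x. Re (f x))"
    by (intro bexI[of _ f]) (auto simp: dual_over_def f_def)
qed

lemma (in complex_inner_space) parallelogram_law:
  fixes x y :: 'a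
  shows "(norm (x + y))\<^sup>2 + (norm (x - y))\<^sup>2 = 2 * (norm x)\<^sup>2 + 2 * (norm y)\<^sup>2"
proof -
  have add_right: "ip a (b + c) = ip a b + ip a c" for a b c
    by (metis ip_commute ip_add_left complex_cnj_add)
  have minus_left: "ip (- a) b = - ip a b" for a b
    using ip_scale_left[of "- 1" a b] by simp
  have minus_right: "ip a (- b) = - ip a b" for a b
    by (metis ip_commute minus_left complex_cnj_minus)
  have "ip (x + y) (x + y) + ip (x + - y) (x + - y) = 2 * ip x x + 2 * ip y y"
    by (simp only: ip_add_left add_right minus_left minus_right) simp
  then have "complex_of_real ((norm (x + y))\<^sup>2 + (norm (x - y))\<^sup>2)
      = of_real (2 * (norm x)\<^sup>2 + 2 * (norm y)\<^sup>2)"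
    by (simp add: ip_self)
  then show ?thesis by (simp only: of_real_eq_iff)
qed

text \<open>Reflexive spaces get the nested property from the bidual, Hilbert spaces straight from
  the parallelogram law, so that their duals never have to be identified.\<close>

theorem corollary3p7:
  shows
   "(\<forall>(D :: 'a::banach set) T.
       separable_space (euclidean :: 'a topology) \<and>
       reflexive_over (scaleR :: real \<Rightarrow> 'a \<Rightarrow> 'a) \<and>
       closed_operator scaleR D T \<longrightarrow>
       fsigma (point_spectrum scaleR D T)) \<and>
    (\<forall>(sc :: complex \<Rightarrow> 'b::banach \<Rightarrow> 'b) D T.
       normed_space_over sc \<and>
       separable_space (euclidean :: 'b topology) \<and>
       reflexive_over sc \<and>
       closed_operator sc D T \<longrightarrow>
       fsigma (point_spectrum sc D T)) \<and>
    (\<forall>(D :: 'c::{real_inner, banach} set) T.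
       separable_space (euclidean :: 'c topology) \<and>
       closed_operator scaleR D T \<and> closure D = UNIV \<longrightarrow>
       fsigma (point_spectrum scaleR D T)) \<and>
    (\<forall>(sc :: complex \<Rightarrow> 'd::banach \<Rightarrow> 'd) ip D T.
       complex_inner_space sc ip \<and>
       separable_space (euclidean :: 'd topology) \<and>
       closed_operator sc D T \<and> closure D = UNIV \<longrightarrow>
       fsigma (point_spectrum sc D T))"
proof (intro conjI allI impI; elim conjE)
  fix D :: "'a set" and T
  assume "separable_space (euclidean :: 'a topology)"
    and "reflexive_over (scaleR :: real \<Rightarrow> 'a \<Rightarrow> 'a)" and "closed_operator scaleR D T"
  then show "fsigma (point_spectrum scaleR D T)"
    by (intro normed_space_over.fsigma_point_spectrum normed_space_over_scaleR
        real_reflexive_imp_nested_convex_property)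
next
  fix sc :: "complex \<Rightarrow> 'b \<Rightarrow> 'b" and D T
  assume "normed_space_over sc" "separable_space (euclidean :: 'b topology)"
    and "reflexive_over sc" "closed_operator sc D T"
  then show "fsigma (point_spectrum sc D T)"
    by (intro normed_space_over.fsigma_point_spectrum
        complex_reflexive_imp_nested_convex_property)
next
  fix D :: "'c set" and T
  assume separable: "separable_space (euclidean :: 'c topology)" and T: "closed_operator scaleR D T"
  have "nested_convex_property TYPE('c)"
    by (rule parallelogram_imp_nested_convex_property)
      (simp add: power2_norm_eq_inner algebra_simps inner_commute)
  then show "fsigma (point_spectrum scaleR D T)"
    using separable T by (intro normed_space_over.fsigma_point_spectrum normed_space_over_scaleR)
next
  fix sc :: "complex \<Rightarrow> 'd \<Rightarrow> 'd" and ip D T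
  assume ip: "complex_inner_space sc ip" and separable: "separable_space (euclidean :: 'd topology)"
    and T: "closed_operator sc D T"
  interpret complex_inner_space sc ip by fact
  have "nested_convex_property TYPE('d)"
    by (rule parallelogram_imp_nested_convex_property) (rule parallelogram_law)
  then show "fsigma (point_spectrum sc D T)"
    using separable T by (rule fsigma_point_spectrum)
qed

end
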